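(* There is a universal constant $\gamma_*>0$ such that the following holds. Let $b>0$ and let $\ell:\mathbb{R}\to\mathbb{R}$ be convex, differentiable and strictly decreasing to $0$, with $\ell(z)=z^{-b}$ for all $z\ge1$. Then there exist constants $0<c_1\le c_2$ and $N\in\mathbb{N}$, not depending on $n$, such that for every $n\ge N$ there is a linearly separable dataset $\{(\boldsymbol{x}_i,y_i)\}_{i=1}^n$ of $n$ examples (with $\boldsymbol{x}_i$ in some $\mathbb{R}^d$, $\|\boldsymbol{x}_i\|\le1$, $y_i\in\{-1,+1\}$) whose maximum margin $$\max_{\|\boldsymbol{u}\|=1}\min_{1\le i\le n}y_i\langle\boldsymbol{u},\boldsymbol{x}_i\rangle$$ equals $\gamma_*$, while the regularization path $\bar{\boldsymbol{w}}(B)=\arg\min_{\|\boldsymbol{w}\|\le B}\frac1n\sum_{i=1}^n\ell(y_i\langle\boldsymbol{w},\boldsymbol{x}_i\rangle)$ converges to a direction $\bar{\boldsymbol{u}}=\lim_{B\to\infty}\bar{\boldsymbol{w}}(B)/B$ whose margin satisfies $$c_1n^{-1/(b+1)}\le\min_{1\le i\le n}y_i\langle\bar{\boldsymbol{u}},\boldsymbol{x}_i\rangle\le c_2n^{-1/(b+1)}.$$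
   Context: $\|\cdot\|$ is the Euclidean norm. "Linearly separable" means there exist a unit vector $\boldsymbol{u}$ and $\gamma>0$ with $y_i\langle\boldsymbol{u},\boldsymbol{x}_i\rangle\ge\gamma$ for all $i$. "Strictly decreasing to $0$" means strictly decreasing with $\lim_{z\to\infty}\ell(z)=0$. For such data and loss, the minimizer $\bar{\boldsymbol{w}}(B)$ is unique. *)

theory Defs
  imports "HOL-Analysis.Analysis"
begin

text \<open>
  The dimension is existentially quantified in the statement, so it cannot be a type.
  Vectors of $\mathbb{R}^d$ are therefore the points of \<^const>\<open>Euclidean_space\<close>, i.e. the functions
  \<^typ>\<open>nat \<Rightarrow> real\<close> that vanish at all indices \<open>\<ge> d\<close>. On them, \<^const>\<open>L2_set\<close> over \<open>{..<d}\<close>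
  is the Euclidean norm, and \<^const>\<open>limitin\<close> in \<^const>\<open>Euclidean_space\<close> is ordinary
  convergence of vectors. Examples are indexed by \<open>{1..n}\<close> and may be repeated.
\<close>

abbreviation Rd :: "nat \<Rightarrow> (nat \<Rightarrow> real) set" where
  "Rd d \<equiv> topspace (Euclidean_space d)"

definition vnorm :: "nat \<Rightarrow> (nat \<Rightarrow> real) \<Rightarrow> real" where
  "vnorm d v = L2_set v {..<d}"

definition vinner :: "nat \<Rightarrow> (nat \<Rightarrow> real) \<Rightarrow> (nat \<Rightarrow> real) \<Rightarrow> real" where
  "vinner d u v = (\<Sum>k<d. u k * v k)"

definition bounded_dataset ::
    "nat \<Rightarrow> nat \<Rightarrow> (nat \<Rightarrow> nat \<Rightarrow> real) \<Rightarrow> (nat \<Rightarrow> real) \<Rightarrow> bool" where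
  "bounded_dataset d n x y \<longleftrightarrow>
     (\<forall>i\<in>{1..n}. x i \<in> Rd d \<and> vnorm d (x i) \<le> 1 \<and> y i \<in> {-1, 1})"

definition linearly_separable ::
    "nat \<Rightarrow> nat \<Rightarrow> (nat \<Rightarrow> nat \<Rightarrow> real) \<Rightarrow> (nat \<Rightarrow> real) \<Rightarrow> bool" where
  "linearly_separable d n x y \<longleftrightarrow>
     (\<exists>u\<in>Rd d. vnorm d u = 1 \<and> (\<exists>\<gamma>>0. \<forall>i\<in>{1..n}. y i * vinner d u (x i) \<ge> \<gamma>))"

definition margin ::
    "nat \<Rightarrow> nat \<Rightarrow> (nat \<Rightarrow> nat \<Rightarrow> real) \<Rightarrow> (nat \<Rightarrow> real) \<Rightarrow> (nat \<Rightarrow> real) \<Rightarrow> real" where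
  "margin d n x y u = Min ((\<lambda>i. y i * vinner d u (x i)) ` {1..n})"

text \<open>The maximum of the margin over the unit sphere exists and equals \<open>g\<close>.\<close>

definition is_max_margin ::
    "nat \<Rightarrow> nat \<Rightarrow> (nat \<Rightarrow> nat \<Rightarrow> real) \<Rightarrow> (nat \<Rightarrow> real) \<Rightarrow> real \<Rightarrow> bool" where
  "is_max_margin d n x y g \<longleftrightarrow>
     (\<exists>u\<in>Rd d. vnorm d u = 1 \<and> margin d n x y u = g) \<and>
     (\<forall>u\<in>Rd d. vnorm d u = 1 \<longrightarrow> margin d n x y u \<le> g)"

definition emp_risk ::
    "(real \<Rightarrow> real) \<Rightarrow> nat \<Rightarrow> nat \<Rightarrow> (nat \<Rightarrow> nat \<Rightarrow> real) \<Rightarrow> (nat \<Rightarrow> real) \<Rightarrow> (nat \<Rightarrow> real) \<Rightarrow> real" where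
  "emp_risk l d n x y w = (1 / real n) * (\<Sum>i=1..n. l (y i * vinner d w (x i)))"

text \<open>
  \<^const>\<open>arg_min_on\<close> selects some minimizer; that there is exactly one, so that the choice is
  immaterial, is the lemma \<open>ex1_minimizer\<close> below.
\<close>

definition reg_path ::
    "(real \<Rightarrow> real) \<Rightarrow> nat \<Rightarrow> nat \<Rightarrow> (nat \<Rightarrow> nat \<Rightarrow> real) \<Rightarrow> (nat \<Rightarrow> real) \<Rightarrow> real \<Rightarrow> (nat \<Rightarrow> real)" where
  "reg_path l d n x y B = arg_min_on (emp_risk l d n x y) {w \<in> Rd d. vnorm d w \<le> B}"

lemma compact_vball: "compact {w \<in> Rd d. vnorm d w \<le> B}"
proof -
  have "compactin (powertop_real UNIV) (PiE UNIV (\<lambda>i::nat. {-B..B}))"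
    by (subst compactin_PiE) auto
  hence c: "compact (PiE UNIV (\<lambda>i::nat. {-B..B}))"
    by (simp add: euclidean_product_topology)
  have "closed (Rd d)"
    using closedin_Euclidean_space by (simp add: euclidean_product_topology)
  moreover have "closed {w. vnorm d w \<le> B}"
    unfolding vnorm_def L2_set_def by (intro closed_Collect_le continuous_intros) auto
  ultimately have "closed (Rd d \<inter> {w. vnorm d w \<le> B})" by (rule closed_Int)
  moreover have "Rd d \<inter> {w. vnorm d w \<le> B} \<subseteq> PiE UNIV (\<lambda>i::nat. {-B..B})"
  proof
    fix w assume "w \<in> Rd d \<inter> {w. vnorm d w \<le> B}"
    hence z: "\<And>i. i \<ge> d \<Longrightarrow> w i = 0" and le: "vnorm d w \<le> B"
      by (auto simp: topspace_Euclidean_space)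
    have "\<bar>w i\<bar> \<le> B" for i
    proof (cases "i < d")
      case True
      then have "\<bar>w i\<bar> \<le> L2_set (\<lambda>i. \<bar>w i\<bar>) {..<d}" by (intro member_le_L2_set) auto
      also have "\<dots> = vnorm d w" by (simp add: vnorm_def L2_set_def)
      finally show ?thesis using le by simp
    next
      case False
      have "0 \<le> vnorm d w" by (simp add: vnorm_def)
      with False z le show ?thesis by simp
    qed
    thus "w \<in> PiE UNIV (\<lambda>i::nat. {-B..B})" by (auto simp: abs_le_iff minus_le_iff)
  qed
  ultimately have "compact ((PiE UNIV (\<lambda>i::nat. {-B..B})) \<inter> (Rd d \<inter> {w. vnorm d w \<le> B}))"
    using c by (intro compact_Int_closed)
  moreover have "(PiE UNIV (\<lambda>i::nat. {-B..B})) \<inter> (Rd d \<inter> {w. vnorm d w \<le> B}) = {w \<in> Rd d. vnorm d w \<le> B}"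
    using \<open>_ \<subseteq> PiE _ _\<close> by auto
  ultimately show ?thesis by simp
qed

lemma ex1_minimizer:
  assumes n: "n \<ge> 1" and sep: "linearly_separable d n x y"
    and cvx: "convex_on UNIV l" and dec: "strict_antimono_on UNIV l" and B: "B \<ge> 0"
  shows "\<exists>!w. is_arg_min (emp_risk l d n x y) (\<lambda>w. w \<in> {w \<in> Rd d. vnorm d w \<le> B}) w"
proof -
  let ?S = "{w \<in> Rd d. vnorm d w \<le> B}" and ?R = "emp_risk l d n x y"
  have cl: "continuous_on UNIV l" using convex_on_continuous[OF open_UNIV cvx] .
  have "continuous_on ?S ?R"
    unfolding emp_risk_def vinner_def
    by (intro continuous_intros continuous_on_compose2[OF cl]
        continuous_on_subset[OF continuous_on_product_coordinates]) auto
  moreover have "(\<lambda>_. 0) \<in> ?S"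
    using B by (auto simp: topspace_Euclidean_space vnorm_def L2_set_def)
  ultimately obtain w0 where w0: "w0 \<in> ?S" "\<forall>w\<in>?S. ?R w0 \<le> ?R w"
    using continuous_attains_inf[OF compact_vball, of d B ?R] by blast
  show ?thesis
  proof (rule ex1I)
    show "is_arg_min ?R (\<lambda>w. w \<in> ?S) w0" using w0 by (auto simp: is_arg_min_linorder)
  next
    fix v assume v: "is_arg_min ?R (\<lambda>w. w \<in> ?S) v"
    show "v = w0"
    proof (rule ccontr)
      assume ne: "v \<noteq> w0"
      have vS: "v \<in> ?S" "?R v \<le> ?R w0" using v w0 by (auto simp: is_arg_min_linorder)
      define m where "m = (\<lambda>k. (v k + w0 k) / 2)"
      obtain u g where u: "u \<in> Rd d" "vnorm d u = 1" "g > 0"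
        and ug: "\<forall>i\<in>{1..n}. y i * vinner d u (x i) \<ge> g"
        using sep unfolding linearly_separable_def by blast
      have sq: "(vnorm d z)\<^sup>2 = (\<Sum>k<d. (z k)\<^sup>2)" for z
        by (simp add: vnorm_def L2_set_def sum_nonneg)
      have nn: "vnorm d z \<ge> 0" for z by (simp add: vnorm_def)
      obtain k0 where k0: "v k0 \<noteq> w0 k0" using ne by blast
      have "k0 < d"
        using k0 vS(1) w0(1) by (force simp: topspace_Euclidean_space not_less[symmetric])
      hence pos: "0 < (\<Sum>k<d. ((v k - w0 k) / 2)\<^sup>2)"
        using k0 by (intro sum_pos2[of _ k0]) auto
      have "(\<Sum>k<d. (m k)\<^sup>2) + (\<Sum>k<d. ((v k - w0 k) / 2)\<^sup>2)
          = (\<Sum>k<d. (v k)\<^sup>2) / 2 + (\<Sum>k<d. (w0 k)\<^sup>2) / 2"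
        unfolding sum.distrib[symmetric] sum_divide_distrib m_def
        by (intro sum.cong) (auto simp: power2_eq_square field_simps)
      hence "(vnorm d m)\<^sup>2 < (vnorm d v)\<^sup>2 / 2 + (vnorm d w0)\<^sup>2 / 2"
        using pos by (simp add: sq)
      also have "\<dots> \<le> B\<^sup>2 / 2 + B\<^sup>2 / 2"
        using vS(1) w0(1) nn by (intro add_mono divide_right_mono power_mono) auto
      finally have mB: "vnorm d m < B" using B by (simp add: power2_less_imp_less)
      define e where "e = B - vnorm d m"
      have e: "e > 0" using mB by (simp add: e_def)
      define z where "z = (\<lambda>k. m k + e * u k)"
      have "vnorm d z \<le> vnorm d m + vnorm d (\<lambda>k. e * u k)"
        unfolding vnorm_def z_def by (rule L2_set_triangle_ineq)
      also have "vnorm d (\<lambda>k. e * u k) = e"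
        using e u(2) L2_set_right_distrib[of e u "{..<d}"] by (simp add: vnorm_def)
      finally have "vnorm d z \<le> B" by (simp add: e_def)
      hence zS: "z \<in> ?S"
        using vS(1) w0(1) u(1) by (auto simp: z_def m_def topspace_Euclidean_space)
      have ipz: "vinner d z (x i) = vinner d m (x i) + e * vinner d u (x i)" for i
        unfolding vinner_def z_def by (simp add: sum_distrib_left sum.distrib algebra_simps)
      have ipm: "vinner d m (x i) = (vinner d v (x i) + vinner d w0 (x i)) / 2" for i
        unfolding vinner_def m_def
        by (simp add: sum.distrib[symmetric] sum_divide_distrib algebra_simps add_divide_distrib)
      have lt: "l (y i * vinner d z (x i))
          < (l (y i * vinner d v (x i)) + l (y i * vinner d w0 (x i))) / 2" if i: "i \<in> {1..n}" for i
      proof -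
        have "0 < y i * vinner d u (x i)" using u(3) ug i by (meson less_le_trans)
        hence "0 < e * (y i * vinner d u (x i))" using e by (simp only: mult_pos_pos)
        hence "y i * vinner d m (x i) < y i * vinner d z (x i)"
          by (simp add: ipz algebra_simps)
        hence "l (y i * vinner d z (x i)) < l (y i * vinner d m (x i))"
          using dec by (auto simp: monotone_on_def)
        also have "y i * vinner d m (x i)
            = (1 - 1/2) * (y i * vinner d v (x i)) + 1/2 * (y i * vinner d w0 (x i))"
          by (simp add: ipm algebra_simps add_divide_distrib)
        also have "l \<dots> \<le> (1 - 1/2) * l (y i * vinner d v (x i)) + 1/2 * l (y i * vinner d w0 (x i))"
          using convex_onD[OF cvx, of "1/2"] by simp
        finally show ?thesis by simp
      qed
      have "(\<Sum>i=1..n. l (y i * vinner d z (x i)))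
          < (\<Sum>i=1..n. (l (y i * vinner d v (x i)) + l (y i * vinner d w0 (x i))) / 2)"
        using n lt by (intro sum_strict_mono) auto
      hence "?R z < (1 / real n) * (\<Sum>i=1..n. (l (y i * vinner d v (x i)) + l (y i * vinner d w0 (x i))) / 2)"
        unfolding emp_risk_def using n by (intro mult_strict_left_mono) auto
      also have "\<dots> = (?R v + ?R w0) / 2"
        by (simp add: emp_risk_def sum_divide_distrib[symmetric] sum.distrib add_divide_distrib)
      also have "\<dots> \<le> ?R w0" using vS(2) by simp
      finally show False using w0(2) zS by force
    qed
  qed
qed

corollary is_arg_min_reg_path:
  assumes "n \<ge> 1" "linearly_separable d n x y"
    and "convex_on UNIV l" "strict_antimono_on UNIV l" "B \<ge> 0"
  shows "is_arg_min (emp_risk l d n x y) (\<lambda>w. w \<in> {w \<in> Rd d. vnorm d w \<le> B}) (reg_path l d n x y B)"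
  using someI_ex[OF ex1_implies_ex[OF ex1_minimizer[OF assms]]]
  by (simp add: reg_path_def arg_min_on_def arg_min_def)

end

theory Submission
  imports Defs
begin

text \<open>
  In the plane, take \<open>n - 1\<close> copies of \<open>(3/5, 4/5)\<close> and one copy of \<open>(3/5, -4/5)\<close>, with margins
  \<open>p\<close> and \<open>q\<close>. The limit direction minimizes \<open>(n - 1) p\<^sup>-\<^sup>b + q\<^sup>-\<^sup>b\<close> over the unit disc. Because the
  examples form an obtuse angle, \<open>q = 0\<close> is reached before \<open>p\<close> is maximal, so near the
  minimum a change of \<open>q\<close> costs the majority a first-order amount; balancing gives
  \<open>n \<approx> (p/q)\<^sup>b\<^sup>+\<^sup>1\<close> with \<open>p\<close> bounded below.
\<close>

section \<open>Risk and regularization path for a loss with a power tail\<close>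

lemma vinner_scale: "vinner d (\<lambda>k. c * u k) v = c * vinner d u v"
  by (simp add: vinner_def sum_distrib_left mult.assoc)

lemma vnorm_scale: "c \<ge> 0 \<Longrightarrow> vnorm d (\<lambda>k. c * u k) = c * vnorm d u"
  using L2_set_right_distrib[of c u "{..<d}"] by (simp add: vnorm_def)

lemma Rd_scale: "u \<in> Rd d \<Longrightarrow> (\<lambda>k. c * u k) \<in> Rd d"
  by (auto simp: topspace_Euclidean_space)

text \<open>In the range where the loss is a pure power the radius factors out, so comparing risks
  at a common radius reduces to comparing sums that do not involve the radius.\<close>

lemma emp_risk_power_tail:
  assumes tail: "\<forall>z\<ge>1. l z = z powr (- b)" and "B > 0"
    and "\<And>i. i \<in> {1..n} \<Longrightarrow> B * (y i * vinner d u (x i)) \<ge> 1"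
  shows "emp_risk l d n x y (\<lambda>k. B * u k)
      = B powr (- b) / n * (\<Sum>i=1..n. (y i * vinner d u (x i)) powr (- b))"
proof -
  have "l (y i * vinner d (\<lambda>k. B * u k) (x i))
      = B powr (- b) * (y i * vinner d u (x i)) powr (- b)" if "i \<in> {1..n}" for i
  proof -
    have "0 < B * (y i * vinner d u (x i))" using assms(3)[OF that] by linarith
    hence "0 \<le> y i * vinner d u (x i)" using \<open>B > 0\<close> by (metis less_imp_le zero_less_mult_pos)
    with assms that show ?thesis
      by (simp add: vinner_scale powr_mult mult.left_commute)
  qed
  thus ?thesis by (simp add: emp_risk_def sum_distrib_left)
qed

text \<open>
  Once all margins of the minimizer exceed 1 the risk is homogeneous of degree \<open>-b\<close> there, so
  rescaling a minimizer gives the minimizer for every larger radius: the normalized path is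
  eventually constant, not merely convergent.
\<close>

lemma reg_path_power_tail:
  assumes n: "n \<ge> 1" and sep: "linearly_separable d n x y"
    and cvx: "convex_on UNIV l" and dec: "strict_antimono_on UNIV l"
    and b: "b > 0" and tail: "\<forall>z\<ge>1. l z = z powr (- b)"
  obtains u where "u \<in> Rd d" "vnorm d u \<le> 1"
    "\<And>i. i \<in> {1..n} \<Longrightarrow> y i * vinner d u (x i) > 0"
    "\<forall>\<^sub>F B in at_top. reg_path l d n x y B = (\<lambda>k. B * u k)"
    "\<And>v. v \<in> Rd d \<Longrightarrow> vnorm d v \<le> 1 \<Longrightarrow> (\<And>i. i \<in> {1..n} \<Longrightarrow> y i * vinner d v (x i) > 0) \<Longrightarrow>
       (\<Sum>i=1..n. (y i * vinner d u (x i)) powr (- b)) \<le> (\<Sum>i=1..n. (y i * vinner d v (x i)) powr (- b))"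
proof -
  let ?R = "emp_risk l d n x y"
  let ?G = "\<lambda>u. \<Sum>i=1..n. (y i * vinner d u (x i)) powr (- b)"
  let ?w = "reg_path l d n x y"
  have anti: "l s < l t \<longleftrightarrow> t < s" for s t
    using dec by (auto simp: monotone_on_def) (metis less_asym' linorder_neqE_linordered_idom)
  \<comment> \<open>The point \<open>max 2 (z + 1)\<close> lies to the right of \<open>z\<close> and
    inside the power range, so positivity there passes back to \<open>z\<close>.\<close>
  have lpos: "l z > 0" for z
  proof -
    have "0 < l (max 2 (z + 1))" using tail by simp
    also have "\<dots> < l z" by (simp add: anti less_max_iff_disj)
    finally show ?thesis .
  qed
  obtain e g where e: "e \<in> Rd d" "vnorm d e = 1" "g > 0"
    and eg: "\<And>i. i \<in> {1..n} \<Longrightarrow> y i * vinner d e (x i) \<ge> g"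
    using sep unfolding linearly_separable_def by blast
  \<comment> \<open>Chosen so that \<open>n\<close> losses at margin \<open>B * g\<close> add up to
    one loss at margin \<open>B * m\<close>, once both margins are in the power range.\<close>
  define m where "m = g * real n powr (- 1 / b)"
  have m: "m > 0" "m \<le> g"
    using e(3) n b powr_mono2[of "1/b" 1 "real n"] by (auto simp: m_def powr_minus_divide mult_le_cancel_left1 field_simps)
  have mn: "(B * m) powr (- b) = n * (B * g) powr (- b)" if "B > 0" for B
    using that e(3) b n by (simp add: m_def powr_mult powr_powr)
  \<comment> \<open>From this radius on, the margin \<open>B * m\<close> is at least 1 and so lies
    in the power range.\<close>
  define B0 where "B0 = 1 / m"
  have B0: "B0 > 0" using m by (simp add: B0_def)
  have Bm: "B * m \<ge> 1" if "B \<ge> B0" for B using that m by (simp add: B0_def field_simps)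
  define U where "U B = (\<lambda>k. ?w B k / B)" for B
  have wU: "?w B = (\<lambda>k. B * U B k)" if "B > 0" for B using that by (auto simp: U_def)
  have wmin: "?w B \<in> Rd d" "vnorm d (?w B) \<le> B"
      "\<And>z. z \<in> Rd d \<Longrightarrow> vnorm d z \<le> B \<Longrightarrow> ?R (?w B) \<le> ?R z" if "B \<ge> 0" for B
    using is_arg_min_reg_path[OF n sep cvx dec that] by (auto simp: is_arg_min_linorder)
  have U: "U B \<in> Rd d" "vnorm d (U B) \<le> 1" if "B > 0" for B
  proof -
    show "U B \<in> Rd d" using wmin(1)[of B] that by (auto simp: U_def topspace_Euclidean_space)
    have "B * vnorm d (U B) \<le> B * 1"
      using wmin(2)[of B] that wU[OF that] vnorm_scale[of B d "U B"] by simp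
    thus "vnorm d (U B) \<le> 1" using that by simp
  qed
  \<comment> \<open>Competing against the separator \<open>e\<close> scaled by \<open>B\<close>
    bounds the total loss, and by positivity every single loss, by \<open>l (B * m)\<close>; strict
    decrease turns this into a margin bound.\<close>
  have marg: "y i * vinner d (U B) (x i) \<ge> m" if B: "B \<ge> B0" and i: "i \<in> {1..n}" for B i
  proof -
    have Bp: "B > 0" using B B0 by linarith
    have Bg: "B * g \<ge> 1" using Bm[OF B] m Bp mult_left_mono[of m g B] by linarith
    have "?R (?w B) \<le> ?R (\<lambda>k. B * e k)"
      using e Bp by (intro wmin) (auto simp: Rd_scale vnorm_scale)
    hence "(\<Sum>i=1..n. l (y i * vinner d (?w B) (x i))) \<le> (\<Sum>i=1..n. l (y i * vinner d (\<lambda>k. B * e k) (x i)))"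
      using n by (simp add: emp_risk_def divide_le_cancel)
    also have "\<dots> \<le> (\<Sum>i=1..n. l (B * g))"
    proof (rule sum_mono)
      fix i assume "i \<in> {1..n}"
      hence "B * g \<le> y i * vinner d (\<lambda>k. B * e k) (x i)"
        using Bp mult_left_mono[OF eg, of i B] by (simp add: vinner_scale mult.left_commute)
      thus "l (y i * vinner d (\<lambda>k. B * e k) (x i)) \<le> l (B * g)"
        using anti by (meson not_less)
    qed
    also have "\<dots> = l (B * m)" using mn[OF Bp] Bg Bm[OF B] tail by simp
    finally have "(\<Sum>i=1..n. l (y i * vinner d (?w B) (x i))) \<le> l (B * m)" .
    moreover have "l (y i * vinner d (?w B) (x i)) \<le> (\<Sum>i=1..n. l (y i * vinner d (?w B) (x i)))"
      using i lpos by (intro member_le_sum) (auto intro: less_imp_le)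
    ultimately have "B * m \<le> y i * vinner d (?w B) (x i)" using anti by (meson not_less order_trans)
    thus ?thesis using Bp by (simp add: wU[OF Bp] vinner_scale mult.left_commute)
  qed
  \<comment> \<open>The direction optimized at radius \<open>B'\<close> is evaluated at another
    radius \<open>B\<close>, which makes directions from different radii comparable.\<close>
  have RU: "?R (\<lambda>k. B * U B' k) = B powr (- b) / n * ?G (U B')" if "B \<ge> B0" "B' \<ge> B0" for B B'
  proof (rule emp_risk_power_tail[OF tail])
    show "B > 0" using that B0 by linarith
    fix i assume "i \<in> {1..n}"
    hence "B * m \<le> B * (y i * vinner d (U B') (x i))"
      using marg[OF that(2)] \<open>B > 0\<close> by (intro mult_left_mono) auto
    thus "1 \<le> B * (y i * vinner d (U B') (x i))" using Bm[OF that(1)] by linarith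
  qed
  have Rle: "?R (?w B) \<le> ?R (\<lambda>k. B * v k)" if "B > 0" "v \<in> Rd d" "vnorm d v \<le> 1" for B v
    using that by (intro wmin) (auto simp: Rd_scale vnorm_scale)
  have Gle: "?G (U B) \<le> ?G (U B')" if "B \<ge> B0" "B' \<ge> B0" for B B'
  proof -
    have "?R (?w B) \<le> ?R (\<lambda>k. B * U B' k)"
      using that B0 by (intro Rle U) auto
    moreover have "B powr (- b) / n > 0" using that B0 n by simp
    ultimately show ?thesis
      using that B0 wU[of B] by (simp add: RU del: times_divide_eq_left)
  qed
  \<comment> \<open>Applying \<open>Gle\<close> in both orders shows that \<open>U B0\<close> scaled
    by \<open>B\<close> attains the optimal risk at radius \<open>B\<close>; uniqueness of the
    minimizer then identifies it with the path.\<close>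
  have path: "?w B = (\<lambda>k. B * U B0 k)" if B: "B \<ge> B0" for B
  proof -
    have Bp: "B > 0" using B B0 by linarith
    have "?R (\<lambda>k. B * U B0 k) = ?R (?w B)"
      using RU[of B B] RU[of B B0] Gle[of B B0] Gle[of B0 B] B wU[OF Bp] by simp
    hence "is_arg_min ?R (\<lambda>w. w \<in> {w \<in> Rd d. vnorm d w \<le> B}) (\<lambda>k. B * U B0 k)"
      using wmin(3)[of B] Bp U[OF B0] by (auto simp: is_arg_min_linorder Rd_scale vnorm_scale)
    thus ?thesis
      using ex1_minimizer[OF n sep cvx dec] is_arg_min_reg_path[OF n sep cvx dec] Bp
      by (blast intro: less_imp_le)
  qed
  show ?thesis
  proof (rule that[of "U B0"])
    show "U B0 \<in> Rd d" "vnorm d (U B0) \<le> 1" using U[OF B0] by auto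
    show "y i * vinner d (U B0) (x i) > 0" if "i \<in> {1..n}" for i
      using marg[of B0 i] that m by simp
    show "\<forall>\<^sub>F B in at_top. ?w B = (\<lambda>k. B * U B0 k)"
      using eventually_ge_at_top[of B0] by eventually_elim (rule path)
    fix v assume v: "v \<in> Rd d" "vnorm d v \<le> 1" "\<And>i. i \<in> {1..n} \<Longrightarrow> y i * vinner d v (x i) > 0"
    \<comment> \<open>The sum makes \<open>B\<close> at least every reciprocal margin of
      \<open>v\<close>, so \<open>v\<close> scaled by \<open>B\<close> reaches the power range; the
      summand \<open>B0\<close> keeps \<open>path\<close> applicable.\<close>
    define B where "B = B0 + (\<Sum>i=1..n. 1 / (y i * vinner d v (x i)))"
    have "(\<Sum>i=1..n. 1 / (y i * vinner d v (x i))) \<ge> 0"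
      using v(3) by (intro sum_nonneg divide_nonneg_pos) auto
    hence ge: "B \<ge> B0" by (simp add: B_def)
    hence Bp: "B > 0" using B0 by linarith
    have "B * (y i * vinner d v (x i)) \<ge> 1" if i: "i \<in> {1..n}" for i
    proof -
      have "1 / (y i * vinner d v (x i)) \<le> (\<Sum>i=1..n. 1 / (y i * vinner d v (x i)))"
        using i v(3) by (intro member_le_sum) (auto intro: less_imp_le)
      hence "1 / (y i * vinner d v (x i)) \<le> B" using B0 by (simp add: B_def)
      thus ?thesis using v(3)[OF i] by (simp only: pos_divide_le_eq)
    qed
    hence "?R (\<lambda>k. B * v k) = B powr (- b) / n * ?G v"
      by (intro emp_risk_power_tail[OF tail Bp])
    moreover have "B powr (- b) / n > 0" using Bp n by simp
    ultimately show "?G (U B0) \<le> ?G v"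
      using Rle[OF Bp v(1,2)] RU[OF ge, of B0] by (simp add: path[OF ge] del: times_divide_eq_left)
  qed
qed

section \<open>The planar dataset and its maximum margin\<close>

definition vec2 :: "real \<Rightarrow> real \<Rightarrow> nat \<Rightarrow> real" where
  "vec2 s t = (\<lambda>k. if k = 0 then s else if k = 1 then t else 0)"

lemma vec2_in_Rd: "vec2 s t \<in> Rd 2"
  by (auto simp: vec2_def topspace_Euclidean_space)

lemma vinner_vec2: "vinner 2 u (vec2 s t) = u 0 * s + u 1 * t"
  by (simp add: vinner_def vec2_def numeral_2_eq_2)

lemma vnorm_2: "vnorm 2 u = sqrt ((u 0)\<^sup>2 + (u 1)\<^sup>2)"
  by (simp add: vnorm_def L2_set_def numeral_2_eq_2)

text \<open>The minority example sits at index \<open>n\<close>. The 3-4-5 triple gives unit vectors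
  with rational coordinates and inner product -7/25.\<close>

definition skew_data :: "nat \<Rightarrow> nat \<Rightarrow> nat \<Rightarrow> real" where
  "skew_data n i = (if i < n then vec2 (3/5) (4/5) else vec2 (3/5) (-4/5))"

lemma sum_skew_data:
  assumes "n \<ge> 1"
  shows "(\<Sum>i=1..n. f (vinner 2 u (skew_data n i)))
      = (real n - 1) * f (3/5 * u 0 + 4/5 * u 1) + f (3/5 * u 0 - 4/5 * u 1)"
proof -
  obtain k where k: "n = Suc k" using assms by (cases n) auto
  have "(\<Sum>i=1..k. f (vinner 2 u (skew_data n i))) = (\<Sum>i=1..k. f (3/5 * u 0 + 4/5 * u 1))"
    by (intro sum.cong) (auto simp: skew_data_def vinner_vec2 k algebra_simps)
  thus ?thesis by (simp add: k skew_data_def vinner_vec2 algebra_simps)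
qed

lemma ball_skew_data:
  assumes "n \<ge> 2"
  shows "(\<forall>i\<in>{1..n}. P (vinner 2 u (skew_data n i)))
      \<longleftrightarrow> P (3/5 * u 0 + 4/5 * u 1) \<and> P (3/5 * u 0 - 4/5 * u 1)"
proof
  assume *: "\<forall>i\<in>{1..n}. P (vinner 2 u (skew_data n i))"
  have "P (vinner 2 u (skew_data n 1))" "P (vinner 2 u (skew_data n n))" using * assms by auto
  thus "P (3/5 * u 0 + 4/5 * u 1) \<and> P (3/5 * u 0 - 4/5 * u 1)"
    using assms by (simp add: skew_data_def vinner_vec2 algebra_simps)
qed (auto simp: skew_data_def vinner_vec2 algebra_simps)

lemma margin_skew_data:
  assumes "n \<ge> 2"
  shows "margin 2 n (skew_data n) (\<lambda>_. 1) u = min (3/5 * u 0 + 4/5 * u 1) (3/5 * u 0 - 4/5 * u 1)"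
proof -
  have "(\<lambda>i. 1 * vinner 2 u (skew_data n i)) ` {1..n} = {3/5 * u 0 + 4/5 * u 1, 3/5 * u 0 - 4/5 * u 1}"
  proof
    show "{3/5 * u 0 + 4/5 * u 1, 3/5 * u 0 - 4/5 * u 1} \<subseteq> (\<lambda>i. 1 * vinner 2 u (skew_data n i)) ` {1..n}"
      using assms
      by (auto simp: skew_data_def vinner_vec2 algebra_simps intro: image_eqI[of _ _ 1] image_eqI[of _ _ n])
  qed (auto simp: skew_data_def vinner_vec2 algebra_simps)
  thus ?thesis by (simp add: margin_def)
qed

text \<open>The smaller of the two margins is at most their average \<open>3/5 * u 0\<close>, hence
  at most 3/5. The first axis attains this, whatever the multiplicities of the examples, so the
  value is the same for all \<open>n\<close>.\<close>

lemma is_max_margin_skew_data: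
  assumes "n \<ge> 2"
  shows "is_max_margin 2 n (skew_data n) (\<lambda>_. 1) (3/5)"
  unfolding is_max_margin_def
proof (intro conjI bexI[of _ "vec2 1 0"] ballI impI)
  show "vnorm 2 (vec2 1 0) = 1" by (simp add: vnorm_2 vec2_def)
  show "margin 2 n (skew_data n) (\<lambda>_. 1) (vec2 1 0) = 3/5"
    using assms by (simp add: margin_skew_data vec2_def)
  fix u :: "nat \<Rightarrow> real" assume "vnorm 2 u = 1"
  hence "sqrt ((u 0)\<^sup>2) \<le> 1" unfolding vnorm_2 by (metis real_sqrt_le_mono le_add_same_cancel1 zero_le_power2)
  hence "u 0 \<le> 1" by simp
  thus "margin 2 n (skew_data n) (\<lambda>_. 1) u \<le> 3/5"
    using assms by (simp add: margin_skew_data min_def)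
qed (rule vec2_in_Rd)

section \<open>The two margins of the limit direction\<close>

text \<open>Stationarity of the objective under rotations, which preserve the constraint.\<close>

lemma skew_stationary:
  fixes s t N b :: real
  defines "p \<equiv> 3/5 * s + 4/5 * t" and "q \<equiv> 3/5 * s - 4/5 * t"
  assumes b: "b > 0" and p: "p > 0" and q: "q > 0"
    and min: "\<And>s' t'. s'\<^sup>2 + t'\<^sup>2 = s\<^sup>2 + t\<^sup>2 \<Longrightarrow> 3/5 * s' + 4/5 * t' > 0 \<Longrightarrow> 3/5 * s' - 4/5 * t' > 0 \<Longrightarrow>
      N * p powr (- b) + q powr (- b)
        \<le> N * (3/5 * s' + 4/5 * t') powr (- b) + (3/5 * s' - 4/5 * t') powr (- b)"
  shows "N * (7 * p + 25 * q) * q powr (b + 1) = (25 * p + 7 * q) * p powr (b + 1)"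
proof -
  \<comment> \<open>\<open>P\<close> and \<open>Q\<close> are the two margins after rotating
    \<open>(s, t)\<close> by the angle \<theta>.\<close>
  define P where "P \<theta> = 3/5 * (cos \<theta> * s - sin \<theta> * t) + 4/5 * (sin \<theta> * s + cos \<theta> * t)" for \<theta>
  define Q where "Q \<theta> = 3/5 * (cos \<theta> * s - sin \<theta> * t) - 4/5 * (sin \<theta> * s + cos \<theta> * t)" for \<theta>
  define f where "f \<theta> = N * P \<theta> powr (- b) + Q \<theta> powr (- b)" for \<theta>
  have PQ0: "P 0 = p" "Q 0 = q" by (auto simp: P_def Q_def p_def q_def)
  have dP: "(P has_real_derivative (4/5 * s - 3/5 * t)) (at 0)"
    unfolding P_def by (auto intro!: derivative_eq_intros)
  have dQ: "(Q has_real_derivative (- 4/5 * s - 3/5 * t)) (at 0)"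
    unfolding Q_def by (auto intro!: derivative_eq_intros)
  define D where "D = N * (- b * p powr (- b - 1) * (4/5 * s - 3/5 * t))
      + (- b * q powr (- b - 1) * (- 4/5 * s - 3/5 * t))"
  have df: "(f has_real_derivative D) (at 0)"
    unfolding f_def D_def
    by (rule derivative_eq_intros dP dQ has_real_derivative_powr[THEN DERIV_chain2] refl
        | use p q PQ0 in simp)+
  \<comment> \<open>Both margins stay positive for small angles, so the rotated points are
    admissible competitors in \<open>min\<close>.\<close>
  have "\<forall>\<^sub>F \<theta> in at 0. P \<theta> > 0 \<and> Q \<theta> > 0"
    using DERIV_isCont[OF dP] DERIV_isCont[OF dQ] p q
    by (auto simp: isCont_def PQ0 intro!: eventually_conj order_tendstoD(1))
  then obtain r where r: "r > 0" "\<And>\<theta>. \<theta> \<noteq> 0 \<Longrightarrow> \<bar>\<theta>\<bar> < r \<Longrightarrow> P \<theta> > 0 \<and> Q \<theta> > 0"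
    by (auto simp: eventually_at dist_real_def)
  have "f 0 \<le> f \<theta>" if "\<bar>0 - \<theta>\<bar> < r" for \<theta>
  proof (cases "\<theta> = 0")
    case False
    have "(cos \<theta> * s - sin \<theta> * t)\<^sup>2 + (sin \<theta> * s + cos \<theta> * t)\<^sup>2 = ((sin \<theta>)\<^sup>2 + (cos \<theta>)\<^sup>2) * (s\<^sup>2 + t\<^sup>2)"
      by algebra
    thus ?thesis
      using r(2)[OF False] that min[of "cos \<theta> * s - sin \<theta> * t" "sin \<theta> * s + cos \<theta> * t"]
      by (simp add: f_def PQ0) (simp add: P_def Q_def)
  qed simp
  hence "D = 0" using DERIV_local_min[OF df r(1)] by blast
  \<comment> \<open>Substitute \<open>s = 5/6 * (p + q)\<close> and
    \<open>t = 5/8 * (p - q)\<close>. The coefficient 7 is -25 times the inner product of the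
    examples: the obtuse angle makes it positive, so rotation still changes the majority margin at
    first order as \<open>q\<close> tends to 0.\<close>
  moreover have "4/5 * s - 3/5 * t = (7 * p + 25 * q) / 24"
    "- 4/5 * s - 3/5 * t = - (25 * p + 7 * q) / 24"
    by (simp_all add: p_def q_def field_simps)
  ultimately have "b * (N * p powr (- b - 1) * (7 * p + 25 * q)) = b * (q powr (- b - 1) * (25 * p + 7 * q))"
    unfolding D_def by (simp only:) (simp add: field_simps)
  hence "N * p powr (- b - 1) * (7 * p + 25 * q) = q powr (- b - 1) * (25 * p + 7 * q)"
    using b by simp
  moreover have "p powr (- b - 1) = 1 / p powr (b + 1)" "q powr (- b - 1) = 1 / q powr (b + 1)"
    using powr_minus_divide[of p "b + 1"] powr_minus_divide[of q "b + 1"] by simp_all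
  ultimately show ?thesis using p q by (simp add: field_simps)
qed

text \<open>Solve for \<open>r\<close> by taking \<open>a\<close>-th roots. For \<open>a\<close> and
  \<open>C\<close> at least 1 the root of \<open>C\<close> is at most \<open>C\<close>, so the
  resulting constants do not depend on the exponent.\<close>

lemma powr_root_le:
  fixes r a n C :: real
  assumes "r > 0" "a \<ge> 1" "n > 0" "C \<ge> 1"
  shows "n * r powr a \<le> C \<Longrightarrow> r \<le> C * n powr (- 1 / a)"
    and "n * r powr a \<ge> 1 / C \<Longrightarrow> r \<ge> 1 / C * n powr (- 1 / a)"
proof -
  have inv: "(s powr a) powr (1 / a) = s" if "s > 0" for s
    using that assms by (simp add: powr_powr)
  have nr: "(n * r powr a) powr (1 / a) = n powr (1 / a) * r"
    using assms inv[of r] by (simp add: powr_mult)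
  have np: "n powr (- 1 / a) = 1 / n powr (1 / a)"
    using powr_minus_divide[of n "1 / a"] by simp
  have C: "C powr (1 / a) \<le> C"
    using powr_mono[of "1 / a" 1 C] assms by simp
  show "r \<le> C * n powr (- 1 / a)" if "n * r powr a \<le> C"
  proof -
    have "n powr (1 / a) * r \<le> C powr (1 / a)"
      using that assms unfolding nr[symmetric] by (intro powr_mono2) auto
    also note C
    finally show ?thesis unfolding np using assms by (simp add: field_simps)
  qed
  show "r \<ge> 1 / C * n powr (- 1 / a)" if "n * r powr a \<ge> 1 / C"
  proof -
    have "1 / C \<le> 1 / C powr (1 / a)" using C assms by (intro divide_left_mono) auto
    also have "\<dots> = (1 / C) powr (1 / a)" using assms by (simp add: powr_divide)
    also have "\<dots> \<le> n powr (1 / a) * r"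
      using that assms unfolding nr[symmetric] by (intro powr_mono2) auto
    finally show ?thesis unfolding np using assms by (simp add: field_simps)
  qed
qed

text \<open>Stationarity confines \<open>(n - 1) * (q / p) powr (b + 1)\<close> to a fixed interval,
  which gives the order of \<open>q / p\<close>; since \<open>p\<close> stays between 3/5 and 1,
  \<open>q\<close> has the same order.\<close>

lemma skew_minimizer_margin:
  fixes s t n b :: real
  defines "p \<equiv> 3/5 * s + 4/5 * t" and "q \<equiv> 3/5 * s - 4/5 * t"
  assumes b: "b > 0" and n: "n \<ge> 5" and p: "p > 0" and q: "q > 0" and st: "s\<^sup>2 + t\<^sup>2 \<le> 1"
    and min: "\<And>s' t'. s'\<^sup>2 + t'\<^sup>2 \<le> 1 \<Longrightarrow> 3/5 * s' + 4/5 * t' > 0 \<Longrightarrow> 3/5 * s' - 4/5 * t' > 0 \<Longrightarrow>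
      (n - 1) * p powr (- b) + q powr (- b)
        \<le> (n - 1) * (3/5 * s' + 4/5 * t') powr (- b) + (3/5 * s' - 4/5 * t') powr (- b)"
  shows "3/20 * n powr (- 1 / (b + 1)) \<le> min p q" "min p q \<le> 8 * n powr (- 1 / (b + 1))"
proof -
  define r where "r = q / p"
  have r: "r > 0" using p q by (simp add: r_def)
  \<comment> \<open>The circle through \<open>(s, t)\<close> lies in the unit disc, so minimality
    over the disc supplies the minimality under rotations.\<close>
  have "(n - 1) * (7 * p + 25 * q) * q powr (b + 1) = (25 * p + 7 * q) * p powr (b + 1)"
    unfolding p_def q_def
    by (rule skew_stationary) (use b p q st min in \<open>auto simp: p_def q_def\<close>)
  hence R: "(n - 1) * r powr (b + 1) = (25 * p + 7 * q) / (7 * p + 25 * q)"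
    using p q by (simp add: r_def powr_divide field_simps)
  have lo: "7/25 \<le> (n - 1) * r powr (b + 1)" and hi: "(n - 1) * r powr (b + 1) \<le> 25/7"
    unfolding R using p q by (simp_all add: field_simps)
  have rp: "0 < r powr (b + 1)" using r by simp
  have lo': "n * r powr (b + 1) \<ge> 1/4" using lo rp unfolding left_diff_distrib by linarith
  \<comment> \<open>Here \<open>n \<ge> 5\<close> matters: 4 exceeds the bound 25/7, which forces
    \<open>r powr (b + 1)\<close> below 1 and makes \<open>q\<close> the smaller margin.\<close>
  have "4 * r powr (b + 1) \<le> (n - 1) * r powr (b + 1)" using n rp by (intro mult_right_mono) auto
  hence r1: "r powr (b + 1) \<le> 25/28" using hi by linarith
  have hi': "n * r powr (b + 1) \<le> 8" using hi r1 unfolding left_diff_distrib by linarith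
  have "r \<le> 1"
  proof (rule ccontr)
    assume "\<not> r \<le> 1"
    hence "1 powr (b + 1) \<le> r powr (b + 1)" using b by (intro powr_mono2) auto
    thus False using r1 by simp
  qed
  hence qp: "q \<le> p" using p by (simp add: r_def)
  have qr: "q = r * p" using p by (simp add: r_def)
  \<comment> \<open>Pythagoras in the orthonormal basis formed by the majority example and its
    perpendicular.\<close>
  have "p\<^sup>2 + (4/5 * s - 3/5 * t)\<^sup>2 = s\<^sup>2 + t\<^sup>2" by (simp add: p_def power2_eq_square field_simps)
  hence "p\<^sup>2 \<le> 1\<^sup>2" using st zero_le_power2[of "4/5 * s - 3/5 * t"] by (simp only: one_power2)
  hence p1: "p \<le> 1" by (rule power2_le_imp_le) simp
  have p2: "p \<ge> 3/5"
  proof -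
    \<comment> \<open>Compare with the max-margin direction \<open>(1, 0)\<close>, both of whose
      margins are 3/5; on the left, \<open>q \<le> p\<close> bounds the minority term from below by
      \<open>p powr (- b)\<close>.\<close>
    have "n * p powr (- b) \<le> (n - 1) * p powr (- b) + q powr (- b)"
      using powr_mono2'[of "- b" q p] qp q b by (simp add: algebra_simps)
    also have "\<dots> \<le> n * (3/5) powr (- b)" using min[of 1 0] by (simp add: algebra_simps)
    finally have "p powr (- b) \<le> (3/5) powr (- b)" using n by simp
    thus ?thesis using b p powr_less_mono2_neg[of "- b" p "3/5"] by (meson not_less neg_less_0_iff_less)
  qed
  have b1: "b + 1 \<ge> 1" "n > 0" using b n by auto
  have "r \<ge> 1/4 * n powr (- 1 / (b + 1))" using powr_root_le(2)[OF r b1, of 4] lo' by simp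
  hence "1/4 * n powr (- 1 / (b + 1)) * (3/5) \<le> r * p" using p2 r by (intro mult_mono) auto
  thus "3/20 * n powr (- 1 / (b + 1)) \<le> min p q" using qp by (simp add: qr min_def)
  have "r \<le> 8 * n powr (- 1 / (b + 1))" using powr_root_le(1)[OF r b1, of 8] hi' by simp
  moreover have "q \<le> r" using p1 r by (simp add: qr mult_le_cancel_left1)
  ultimately show "min p q \<le> 8 * n powr (- 1 / (b + 1))" using qp by (simp add: min_def)
qed

section \<open>Margin of the limit of the regularization path on the planar dataset\<close>

theorem proposition12:
  "\<exists>\<gamma>star::real. \<gamma>star > 0 \<and>
     (\<forall>(b::real) (l::real \<Rightarrow> real).
        b > 0 \<longrightarrow> convex_on UNIV l \<longrightarrow> l differentiable_on UNIV \<longrightarrow>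
        strict_antimono_on UNIV l \<longrightarrow> (l \<longlongrightarrow> 0) at_top \<longrightarrow>
        (\<forall>z\<ge>1. l z = z powr (- b)) \<longrightarrow>
        (\<exists>(c1::real) (c2::real) (N::nat). 0 < c1 \<and> c1 \<le> c2 \<and>
           (\<forall>n\<ge>N. \<exists>(d::nat) (x::nat \<Rightarrow> nat \<Rightarrow> real) (y::nat \<Rightarrow> real).
              bounded_dataset d n x y \<and> linearly_separable d n x y \<and>
              is_max_margin d n x y \<gamma>star \<and>
              (\<exists>ubar. limitin (Euclidean_space d) (\<lambda>B k. reg_path l d n x y B k / B) ubar at_top \<and>
                 c1 * real n powr (- 1 / (b + 1)) \<le> margin d n x y ubar \<and>
                 margin d n x y ubar \<le> c2 * real n powr (- 1 / (b + 1))))))"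
proof (rule exI[of _ "3/5"], intro conjI allI impI)
  fix b :: real and l :: "real \<Rightarrow> real"
  assume b: "b > 0" and cvx: "convex_on UNIV l" and dec: "strict_antimono_on UNIV l"
    and tail: "\<forall>z\<ge>1. l z = z powr (- b)"
  show "\<exists>(c1::real) (c2::real) (N::nat). 0 < c1 \<and> c1 \<le> c2 \<and>
           (\<forall>n\<ge>N. \<exists>(d::nat) (x::nat \<Rightarrow> nat \<Rightarrow> real) (y::nat \<Rightarrow> real).
              bounded_dataset d n x y \<and> linearly_separable d n x y \<and>
              is_max_margin d n x y (3/5) \<and>
              (\<exists>ubar. limitin (Euclidean_space d) (\<lambda>B k. reg_path l d n x y B k / B) ubar at_top \<and>
                 c1 * real n powr (- 1 / (b + 1)) \<le> margin d n x y ubar \<and>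
                 margin d n x y ubar \<le> c2 * real n powr (- 1 / (b + 1))))"
  \<comment> \<open>The factor 3/20 is 1/4 from the lower bound on \<open>q / p\<close> times 3/5
    from the bound on \<open>p\<close>; 8 bounds \<open>q / p\<close> and, as
    \<open>p \<le> 1\<close>, also \<open>q\<close>. The threshold 5 is the one of
    \<open>skew_minimizer_margin\<close>.\<close>
  proof (rule exI[of _ "3/20"], rule exI[of _ 8], rule exI[of _ 5], intro conjI allI impI)
    fix n :: nat assume n5: "n \<ge> 5"
    hence n: "n \<ge> 2" "n \<ge> 1" by auto
    let ?x = "skew_data n" and ?y = "\<lambda>_::nat. 1::real"
    have bd: "bounded_dataset 2 n ?x ?y"
      by (auto simp: bounded_dataset_def skew_data_def vec2_in_Rd vnorm_2)
         (auto simp: vec2_def power2_eq_square)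
    have sep: "linearly_separable 2 n ?x ?y"
      unfolding linearly_separable_def
      by (intro bexI[of _ "vec2 1 0"] exI[of _ "3/5"] conjI)
         (auto simp: vec2_in_Rd vnorm_2 skew_data_def vinner_vec2, simp_all add: vec2_def)
    obtain u where u: "u \<in> Rd 2" "vnorm 2 u \<le> 1"
      "\<forall>i\<in>{1..n}. vinner 2 u (?x i) > 0"
      "\<forall>\<^sub>F B in at_top. reg_path l 2 n ?x ?y B = (\<lambda>k. B * u k)"
      and um: "\<And>v. v \<in> Rd 2 \<Longrightarrow> vnorm 2 v \<le> 1 \<Longrightarrow> \<forall>i\<in>{1..n}. vinner 2 v (?x i) > 0 \<Longrightarrow>
       (\<Sum>i=1..n. vinner 2 u (?x i) powr (- b)) \<le> (\<Sum>i=1..n. vinner 2 v (?x i) powr (- b))"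
      by (rule reg_path_power_tail[OF n(2) sep cvx dec b tail]) auto
    have pos: "3/5 * u 0 + 4/5 * u 1 > 0" "3/5 * u 0 - 4/5 * u 1 > 0"
      using u(3) ball_skew_data[OF n(1), of "\<lambda>z. z > 0" u] by auto
    have uu: "(u 0)\<^sup>2 + (u 1)\<^sup>2 \<le> 1" using u(2) by (simp add: vnorm_2)
    have "(real n - 1) * (3/5 * u 0 + 4/5 * u 1) powr (- b) + (3/5 * u 0 - 4/5 * u 1) powr (- b)
        \<le> (real n - 1) * (3/5 * s + 4/5 * t) powr (- b) + (3/5 * s - 4/5 * t) powr (- b)"
      if "s\<^sup>2 + t\<^sup>2 \<le> 1" "3/5 * s + 4/5 * t > 0" "3/5 * s - 4/5 * t > 0" for s t
      using um[of "vec2 s t"] that vec2_in_Rd[of s t]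
        ball_skew_data[OF n(1), of "\<lambda>z. z > 0" "vec2 s t"]
        sum_skew_data[OF n(2), of "\<lambda>z. z powr (- b)" "vec2 s t"]
        sum_skew_data[OF n(2), of "\<lambda>z. z powr (- b)" u]
      by (simp add: vnorm_2 vec2_def[of s t])
    note bounds = skew_minimizer_margin[OF b _ pos uu this, folded margin_skew_data[OF n(1)]]
    \<comment> \<open>The normalized path equals \<open>u\<close> for all large radii;
      \<open>B > 0\<close> is what allows cancelling the radius.\<close>
    have "\<forall>\<^sub>F B in at_top. (\<lambda>k. reg_path l 2 n ?x ?y B k / B) = u"
      using u(4) eventually_gt_at_top[of 0] by eventually_elim auto
    hence lim: "limitin (Euclidean_space 2) (\<lambda>B k. reg_path l 2 n ?x ?y B k / B) u at_top"
      using u(1) by (intro limitin_eventually)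
    show "\<exists>(d::nat) (x::nat \<Rightarrow> nat \<Rightarrow> real) (y::nat \<Rightarrow> real).
              bounded_dataset d n x y \<and> linearly_separable d n x y \<and>
              is_max_margin d n x y (3/5) \<and>
              (\<exists>ubar. limitin (Euclidean_space d) (\<lambda>B k. reg_path l d n x y B k / B) ubar at_top \<and>
                 3/20 * real n powr (- 1 / (b + 1)) \<le> margin d n x y ubar \<and>
                 margin d n x y ubar \<le> 8 * real n powr (- 1 / (b + 1)))"
      using bd sep is_max_margin_skew_data[OF n(1)] lim bounds n5
      by (intro exI[of _ 2] exI[of _ ?x] exI[of _ ?y] conjI exI[of _ u]) auto
  qed auto
qed auto

end
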